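(* Let $\mathscr{G} = (\mathscr{V}, \mathscr{E})$ be a finite connected graph with $N \ge 2$ vertices, let $\rho_x > 0$ for $x \in \mathscr{V}$, and consider the simple exclusion process on $\mathscr{G}$ with rates $(\rho_x)_{x \in \mathscr{V}}$ and transition rates $q$. For all $K = 0, 1, \ldots, N$, the distribution $$ \pi_K(\eta) = \frac{D(\eta)}{\Sigma(\Lambda_K)} \quad \text{for all } \eta \in \Lambda_K $$ is a reversible distribution concentrated on $\Lambda_K$; that is, it is a probability distribution on $\Lambda_K$ and $\pi_K(\eta)\, q(\eta,\xi) = \pi_K(\xi)\, q(\xi,\eta)$ for all $\eta, \xi \in \Lambda_K$ with $\eta \ne \xi$.
   Context: Graphs are undirected, without loops or multiple edges; $\deg(x)$ is the degree of $x$. A configuration is a map $\eta : \mathscr{V} \to \{0,1\}$, where $\eta(x) = 1$ means that $x$ is occupied by a particle and $\eta(x) = 0$ that $x$ is empty. A configuration $\eta$ is identified with the subset $\{x \in \mathscr{V} : \eta(x) = 1\}$ of $\mathscr{V}$. For $x, y \in \mathscr{V}$, $\tau_{x,y}\eta$ is the configuration obtained from $\eta$ by exchanging the states at $x$ and $y$. The simple exclusion process with rates $(\rho_x)$ is the continuous-time Markov chain $(\eta_t)_{t\ge 0}$ on $\{0,1\}^{\mathscr{V}}$ that jumps from $\eta$ to $\xi \ne \eta$ at rate $q(\eta,\xi) = \rho_x/\deg(x)$ if $\xi = \tau_{x,y}\eta$ for some edge $(x,y) \in \mathscr{E}$ with $\eta(x) = 1$ (hence $\eta(y) = 0$), and at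 rate $q(\eta,\xi) = 0$ otherwise. $\Lambda_K$ is the set of configurations with exactly $K$ particles. For $z \in \mathscr{V}$, $\eta \subset \mathscr{V}$, and a collection $\mathscr{C}$ of subsets of $\mathscr{V}$, $$ D(z) = \frac{\deg(z)}{\rho_z}, \quad D(\eta) = \prod_{z \in \eta} D(z), \quad \Sigma(\mathscr{C}) = \sum_{\eta \in \mathscr{C}} D(\eta), $$ with the empty product equal to $1$. *)

theory Defs
  imports
    Complex_Main
    "HOL-Combinatorics.Transposition"
    "Graph_Theory.Digraph_Component"
begin

text \<open>
  Undirected finite simple graphs are the symmetric digraphs of locale \<^locale>\<open>graph\<close>: an edge
  between \<open>x\<close> and \<open>y\<close> is a pair of opposite arcs. A vertex thus has exactly one outgoing arc per
  incident edge, so its degree is its out-degree.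
\<close>

abbreviation deg :: "('v, 'e) pre_digraph \<Rightarrow> 'v \<Rightarrow> nat" where
  "deg G x \<equiv> out_degree G x"

text \<open>
  Configurations are identified with the set of their occupied vertices, so \<open>\<eta>(x) = 1\<close> is
  \<open>x \<in> \<eta>\<close>. The state of \<open>swap x y \<eta>\<close> at \<open>z\<close> is the state of \<open>\<eta>\<close> at \<open>transpose x y z\<close>.
\<close>

definition swap :: "'v \<Rightarrow> 'v \<Rightarrow> 'v set \<Rightarrow> 'v set" where
  "swap x y \<eta> = Transposition.transpose x y -` \<eta>"

definition jump :: "('v, 'e) pre_digraph \<Rightarrow> 'v set \<Rightarrow> 'v set \<Rightarrow> 'v \<Rightarrow> 'v \<Rightarrow> bool" where
  "jump G \<eta> \<xi> x y \<longleftrightarrow> \<xi> \<noteq> \<eta> \<and> x \<rightarrow>\<^bsub>G\<^esub> y \<and> x \<in> \<eta> \<and> \<xi> = swap x y \<eta>"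

text \<open>
  The vertex \<open>x\<close> that the particle leaves is determined by \<open>\<eta>\<close> and \<open>\<xi>\<close>; see \<open>jump_unique\<close>.
  The value on the diagonal \<open>\<xi> = \<eta>\<close> carries no meaning (it is \<open>0\<close>).
\<close>

definition exclusion_rate ::
    "('v, 'e) pre_digraph \<Rightarrow> ('v \<Rightarrow> real) \<Rightarrow> 'v set \<Rightarrow> 'v set \<Rightarrow> real" where
  "exclusion_rate G \<rho> \<eta> \<xi> =
     (if \<exists>x y. jump G \<eta> \<xi> x y
      then let x = (THE x. \<exists>y. jump G \<eta> \<xi> x y) in \<rho> x / real (deg G x)
      else 0)"

definition Lambda :: "('v, 'e) pre_digraph \<Rightarrow> nat \<Rightarrow> 'v set set" where
  "Lambda G K = {\<eta>. \<eta> \<subseteq> verts G \<and> card \<eta> = K}"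

definition D_vertex :: "('v, 'e) pre_digraph \<Rightarrow> ('v \<Rightarrow> real) \<Rightarrow> 'v \<Rightarrow> real" where
  "D_vertex G \<rho> z = real (deg G z) / \<rho> z"

definition D_conf :: "('v, 'e) pre_digraph \<Rightarrow> ('v \<Rightarrow> real) \<Rightarrow> 'v set \<Rightarrow> real" where
  "D_conf G \<rho> \<eta> = (\<Prod>z\<in>\<eta>. D_vertex G \<rho> z)"

definition D_sum :: "('v, 'e) pre_digraph \<Rightarrow> ('v \<Rightarrow> real) \<Rightarrow> 'v set set \<Rightarrow> real" where
  "D_sum G \<rho> C = (\<Sum>\<eta>\<in>C. D_conf G \<rho> \<eta>)"

definition pi_dist :: "('v, 'e) pre_digraph \<Rightarrow> ('v \<Rightarrow> real) \<Rightarrow> nat \<Rightarrow> 'v set \<Rightarrow> real" where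
  "pi_dist G \<rho> K \<eta> = D_conf G \<rho> \<eta> / D_sum G \<rho> (Lambda G K)"

definition prob_distribution_on :: "'s set \<Rightarrow> ('s \<Rightarrow> real) \<Rightarrow> bool" where
  "prob_distribution_on S p \<longleftrightarrow> finite S \<and> (\<forall>s\<in>S. 0 \<le> p s) \<and> (\<Sum>s\<in>S. p s) = 1"

definition reversible_distribution_on :: "'s set \<Rightarrow> ('s \<Rightarrow> 's \<Rightarrow> real) \<Rightarrow> ('s \<Rightarrow> real) \<Rightarrow> bool" where
  "reversible_distribution_on S q p \<longleftrightarrow>
     prob_distribution_on S p \<and>
     (\<forall>s\<in>S. \<forall>t\<in>S. s \<noteq> t \<longrightarrow> p s * q s t = p t * q t s)"

lemma jump_iff:
  "jump G \<eta> \<xi> x y \<longleftrightarrow> x \<rightarrow>\<^bsub>G\<^esub> y \<and> x \<in> \<eta> \<and> y \<notin> \<eta> \<and> \<xi> = insert y (\<eta> - {x})"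
proof -
  have "swap x y \<eta> = \<eta>" if "x \<in> \<eta>" "y \<in> \<eta>"
    using that unfolding swap_def by (auto simp: Transposition.transpose_def split: if_splits)
  moreover have "swap x y \<eta> = insert y (\<eta> - {x})" if "x \<in> \<eta>" "y \<notin> \<eta>"
    using that unfolding swap_def by (auto simp: Transposition.transpose_def split: if_splits)
  ultimately show ?thesis
    unfolding jump_def by (cases "y \<in> \<eta>") auto
qed

lemma jump_unique:
  assumes "jump G \<eta> \<xi> x y" "jump G \<eta> \<xi> x' y'"
  shows "x = x'" "y = y'"
proof -
  have "\<eta> - \<xi> = {x} \<and> \<xi> - \<eta> = {y}" "\<eta> - \<xi> = {x'} \<and> \<xi> - \<eta> = {y'}"
    using assms unfolding jump_iff by auto
  then show "x = x'" "y = y'" by simp_all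
qed

lemma exclusion_rate_jump:
  assumes "jump G \<eta> \<xi> x y"
  shows "exclusion_rate G \<rho> \<eta> \<xi> = \<rho> x / real (deg G x)"
proof -
  have "(THE x. \<exists>y. jump G \<eta> \<xi> x y) = x"
    using assms by (blast dest: jump_unique(1))
  with assms show ?thesis
    unfolding exclusion_rate_def by auto
qed

lemma exclusion_rate_no_jump:
  "\<nexists>x y. jump G \<eta> \<xi> x y \<Longrightarrow> exclusion_rate G \<rho> \<eta> \<xi> = 0"
  unfolding exclusion_rate_def by auto

end

theory Submission
  imports Defs
begin

text \<open>
  A jump from \<open>\<eta>\<close> to \<open>\<xi>\<close> moves one particle from \<open>x\<close> to a neighbour \<open>y\<close>, and its rate
  \<open>\<rho> x / deg x\<close> is the inverse of the factor that \<open>x\<close> contributes to \<open>D(\<eta>)\<close>. The unnormalised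
  flow \<open>D(\<eta>) q(\<eta>,\<xi>)\<close> is therefore the weight \<open>D(\<eta> \<inter> \<xi>)\<close> of the particles that stay in place
  (\<open>D_conf_times_rate\<close>), which is symmetric in \<open>\<eta>\<close> and \<open>\<xi>\<close>. Edges are undirected, so the
  reverse jump is possible exactly when the jump is (\<open>jump_reverse\<close>), and detailed balance
  follows upon division by \<open>\<Sigma>(\<Lambda>\<^sub>K)\<close>.

  For this division to yield a probability distribution the normalising sum must be positive.
  Connectedness enters here: with at least two vertices it excludes isolated vertices
  (\<open>out_degree_pos\<close>), so all weights are positive, and \<open>\<Lambda>\<^sub>K\<close> is nonempty as \<open>K \<le> N\<close>.
\<close>

text \<open>
  A path from \<open>x\<close> to some other vertex has a first arc, which leaves \<open>x\<close>.
\<close>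

lemma out_degree_pos:
  assumes "graph G" "Digraph_Component.connected G" "card (verts G) \<ge> 2" "x \<in> verts G"
  shows "out_degree G x > 0"
proof -
  interpret graph G by fact
  have "verts G \<noteq> {x}"
    using \<open>card (verts G) \<ge> 2\<close> by auto
  then obtain y where "y \<in> verts G" "y \<noteq> x"
    using \<open>x \<in> verts G\<close> by blast
  moreover have "strongly_connected G"
    using sym_arcs \<open>Digraph_Component.connected G\<close>
    by (rule symmetric_connected_imp_strongly_connected)
  ultimately have "x \<rightarrow>\<^sup>*\<^bsub>G\<^esub> y"
    using \<open>x \<in> verts G\<close> by auto
  then obtain z where "x \<rightarrow>\<^bsub>G\<^esub> z"
    using \<open>y \<noteq> x\<close> by (cases rule: converse_reachable_cases) auto
  then have "out_arcs G x \<noteq> {}"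
    by (auto simp: out_arcs_def arcs_ends_def arc_to_ends_def)
  then show ?thesis
    unfolding out_degree_def using finite_out_arcs by (simp add: card_gt_0_iff)
qed

lemma D_vertex_pos: "out_degree G z > 0 \<Longrightarrow> \<rho> z > 0 \<Longrightarrow> D_vertex G \<rho> z > 0"
  by (simp add: D_vertex_def)

lemma D_conf_pos:
  assumes "\<And>z. z \<in> \<eta> \<Longrightarrow> D_vertex G \<rho> z > 0"
  shows "D_conf G \<rho> \<eta> > 0"
  unfolding D_conf_def using assms by (simp add: prod_pos)

lemma jump_reverse:
  assumes "symmetric G" "jump G \<eta> \<xi> x y"
  shows "jump G \<xi> \<eta> y x"
proof -
  have "y \<rightarrow>\<^bsub>G\<^esub> x"
    using assms unfolding symmetric_def jump_def by (blast dest: symD)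
  then show ?thesis
    using assms(2) unfolding jump_iff by auto
qed

text \<open>
  The rate is \<open>1 / D(x)\<close>, so it removes the factor of the vertex that the particle leaves; what
  remains is the weight of \<open>\<eta> - {x} = \<eta> \<inter> \<xi>\<close>.
\<close>

lemma D_conf_times_rate:
  assumes "finite \<eta>" "jump G \<eta> \<xi> x y" "D_vertex G \<rho> x \<noteq> 0"
  shows "D_conf G \<rho> \<eta> * exclusion_rate G \<rho> \<eta> \<xi> = D_conf G \<rho> (\<eta> \<inter> \<xi>)"
proof -
  have "x \<in> \<eta>" "\<eta> \<inter> \<xi> = \<eta> - {x}"
    using assms(2) unfolding jump_iff by auto
  then have "D_conf G \<rho> \<eta> = D_vertex G \<rho> x * D_conf G \<rho> (\<eta> \<inter> \<xi>)"
    unfolding D_conf_def using \<open>finite \<eta>\<close> by (simp add: prod.remove)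
  then show ?thesis
    using assms(3) by (simp add: exclusion_rate_jump[OF assms(2)] D_vertex_def)
qed

lemma D_conf_detailed_balance:
  assumes "symmetric G" "finite \<eta>" "finite \<xi>"
    and nz: "\<And>z. z \<in> \<eta> \<union> \<xi> \<Longrightarrow> D_vertex G \<rho> z \<noteq> 0"
  shows "D_conf G \<rho> \<eta> * exclusion_rate G \<rho> \<eta> \<xi> = D_conf G \<rho> \<xi> * exclusion_rate G \<rho> \<xi> \<eta>"
proof (cases "\<exists>x y. jump G \<eta> \<xi> x y")
  case True
  then obtain x y where j: "jump G \<eta> \<xi> x y"
    by blast
  then have j': "jump G \<xi> \<eta> y x"
    by (rule jump_reverse[OF \<open>symmetric G\<close>])
  have "x \<in> \<eta>" "y \<in> \<xi>"
    using j j' by (simp_all add: jump_def)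
  then show ?thesis
    using D_conf_times_rate[OF \<open>finite \<eta>\<close> j] D_conf_times_rate[OF \<open>finite \<xi>\<close> j'] nz
    by (simp add: Int_commute)
next
  case False
  then have "\<nexists>x y. jump G \<xi> \<eta> x y"
    using jump_reverse[OF \<open>symmetric G\<close>] by blast
  with False show ?thesis
    by (simp add: exclusion_rate_no_jump)
qed

lemma finite_Lambda: "finite (verts G) \<Longrightarrow> finite (Lambda G K)"
  unfolding Lambda_def by (rule finite_subset[of _ "Pow (verts G)"]) auto

lemma Lambda_nonempty: "K \<le> card (verts G) \<Longrightarrow> Lambda G K \<noteq> {}"
  unfolding Lambda_def by (auto elim: obtain_subset_with_card_n)

theorem lemma7:
  fixes G :: "('v, 'e) pre_digraph" and \<rho> :: "'v \<Rightarrow> real" and K :: nat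
  assumes "graph G" and "Digraph_Component.connected G" and "card (verts G) \<ge> 2"
    and "\<And>x. x \<in> verts G \<Longrightarrow> \<rho> x > 0"
    and "K \<le> card (verts G)"
  shows "reversible_distribution_on (Lambda G K) (exclusion_rate G \<rho>) (pi_dist G \<rho> K)"
proof -
  interpret graph G by fact
  let ?L = "Lambda G K" and ?Z = "D_sum G \<rho> (Lambda G K)"
  have vertex_pos: "D_vertex G \<rho> z > 0" if "z \<in> verts G" for z
    using that assms by (intro D_vertex_pos out_degree_pos)
  have sub: "\<eta> \<subseteq> verts G" if "\<eta> \<in> ?L" for \<eta>
    using that by (simp add: Lambda_def)
  have conf_pos: "D_conf G \<rho> \<eta> > 0" if "\<eta> \<in> ?L" for \<eta>
    using sub[OF that] by (blast intro: D_conf_pos vertex_pos)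
  have fin: "finite ?L"
    by (simp add: finite_Lambda)
  have Z_pos: "?Z > 0"
    unfolding D_sum_def using fin Lambda_nonempty[OF assms(5)] conf_pos by (rule sum_pos)
  have "(\<Sum>\<eta>\<in>?L. pi_dist G \<rho> K \<eta>) = 1"
    using Z_pos by (simp add: pi_dist_def D_sum_def flip: sum_divide_distrib)
  moreover have "0 \<le> pi_dist G \<rho> K \<eta>" if "\<eta> \<in> ?L" for \<eta>
    using conf_pos[OF that] Z_pos by (simp add: pi_dist_def)
  moreover have "pi_dist G \<rho> K \<eta> * exclusion_rate G \<rho> \<eta> \<xi> = pi_dist G \<rho> K \<xi> * exclusion_rate G \<rho> \<xi> \<eta>"
    if "\<eta> \<in> ?L" "\<xi> \<in> ?L" for \<eta> \<xi>
  proof -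
    have "finite \<eta>" "finite \<xi>"
      using that by (blast intro: finite_subset[OF sub finite_verts])+
    moreover have "D_vertex G \<rho> z \<noteq> 0" if "z \<in> \<eta> \<union> \<xi>" for z
      using that sub[OF \<open>\<eta> \<in> ?L\<close>] sub[OF \<open>\<xi> \<in> ?L\<close>] vertex_pos[of z] by auto
    ultimately have "D_conf G \<rho> \<eta> * exclusion_rate G \<rho> \<eta> \<xi> = D_conf G \<rho> \<xi> * exclusion_rate G \<rho> \<xi> \<eta>"
      by (intro D_conf_detailed_balance sym_arcs)
    then show ?thesis
      by (simp add: pi_dist_def)
  qed
  ultimately show ?thesis
    using fin by (simp add: reversible_distribution_on_def prob_distribution_on_def)
qed

end
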